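(* Let $s$ be a positive even integer and let $t,r$ be positive integers. Then, as formal power series in $x$, $$U(x;t+r;s)=U(x;t;s)\,U(x;r;s).$$
   Context: For a positive even integer $s$, a positive integer $t$ and an integer $m\ge0$, $W^{(s)}_{(t)}(m)$ denotes the number of ways in which $m$ can be written as a sum of $s$-th powers of $t$ integers, i.e. the number of ordered tuples $(n_1,\dots,n_t)\in\mathbb{Z}^t$ with $m=n_1^s+n_2^s+\cdots+n_t^s$. Its generating function is $U(x;t;s)=\sum_{m\ge 0}W^{(s)}_{(t)}(m)\,x^m$ (equivalently the sum over the set $B$ of those $m$ that are expressible in this form). *)

theory Defs
  imports "HOL-Computational_Algebra.Formal_Power_Series"
begin

definition power_reps :: "nat \<Rightarrow> nat \<Rightarrow> nat \<Rightarrow> int list set" where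
  "power_reps s t m = {ns. length ns = t \<and> (\<Sum>n\<leftarrow>ns. n ^ s) = int m}"

(* card returns 0 on infinite sets; for even s > 0 the set is finite, see finite_power_reps. *)
definition W :: "nat \<Rightarrow> nat \<Rightarrow> nat \<Rightarrow> nat" where
  "W s t m = card (power_reps s t m)"

definition U :: "nat \<Rightarrow> nat \<Rightarrow> int fps" where
  "U t s = Abs_fps (\<lambda>m. int (W s t m))"

lemma finite_power_reps:
  assumes "even s" and "s > 0"
  shows "finite (power_reps s t m)"
proof (rule finite_subset)
  show "power_reps s t m \<subseteq> {ns. set ns \<subseteq> {- int m..int m} \<and> length ns = t}"
  proof (clarsimp simp: power_reps_def)
    fix ns :: "int list" and n
    assume sm: "(\<Sum>n\<leftarrow>ns. n ^ s) = int m" and n: "n \<in> set ns"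
    have "n ^ s \<le> (\<Sum>n\<leftarrow>ns. n ^ s)"
      using n assms by (intro member_le_sum_list) (auto simp: zero_le_even_power)
    moreover have "\<bar>n\<bar> \<le> \<bar>n\<bar> ^ s"
      using assms by (cases "n = 0") (auto intro!: self_le_power)
    moreover have "\<bar>n\<bar> ^ s = n ^ s"
      using assms by (simp add: power_even_abs)
    ultimately have "\<bar>n\<bar> \<le> int m" using sm by linarith
    then show "- int m \<le> n \<and> n \<le> int m" by linarith
  qed
  show "finite {ns. set ns \<subseteq> {- int m..int m} \<and> length ns = t}"
    by (rule finite_lists_length_eq) simp
qed

end

theory Submission
  imports Defs
begin

text \<open>Cutting a representation of \<open>m\<close> by \<open>t + r\<close> powers after its
  first \<open>t\<close> entries gives representations of some \<open>i\<close> \<le>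
  \<open>m\<close> and of \<open>m - i\<close>; concatenation undoes the cut. Counting both sides of
  this bijection (\<open>W_add\<close>) yields the Cauchy convolution, which is the coefficient rule
  for a product of power series.\<close>

lemma bij_betw_append_power_reps:
  assumes "even s"
  shows "bij_betw (\<lambda>(i, xs, ys). xs @ ys)
    (SIGMA i:{0..m}. power_reps s t i \<times> power_reps s r (m - i)) (power_reps s (t + r) m)"
proof (rule bij_betw_imageI)
  \<comment> \<open>The fixed length \<open>t\<close> of \<open>xs\<close> determines where to cut,
    and \<open>i\<close> is recovered as the power sum of \<open>xs\<close>.\<close>
  show "inj_on (\<lambda>(i, xs, ys). xs @ ys)
    (SIGMA i:{0..m}. power_reps s t i \<times> power_reps s r (m - i))"
    by (auto simp: inj_on_def power_reps_def)
  show "(\<lambda>(i, xs, ys). xs @ ys) `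
    (SIGMA i:{0..m}. power_reps s t i \<times> power_reps s r (m - i)) = power_reps s (t + r) m"
  proof
    show "power_reps s (t + r) m \<subseteq> (\<lambda>(i, xs, ys). xs @ ys) `
      (SIGMA i:{0..m}. power_reps s t i \<times> power_reps s r (m - i))"
    proof
      fix ns assume ns: "ns \<in> power_reps s (t + r) m"
      define a b where "a = (\<Sum>n\<leftarrow>take t ns. n ^ s)" and "b = (\<Sum>n\<leftarrow>drop t ns. n ^ s)"
      \<comment> \<open>Evenness of \<open>s\<close> enters here: both partial sums are nonnegative,
        so \<open>nat a\<close> loses nothing and lies in \<open>{0..m}\<close>.\<close>
      have "a \<ge> 0" "b \<ge> 0"
        unfolding a_def b_def using assms by (auto intro!: sum_list_nonneg simp: zero_le_even_power)
      moreover have "a + b = int m"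
        using ns append_take_drop_id[of t ns] unfolding a_def b_def power_reps_def
        by (metis (mono_tags, lifting) map_append mem_Collect_eq sum_list_append)
      ultimately have "(nat a, take t ns, drop t ns) \<in>
          (SIGMA i:{0..m}. power_reps s t i \<times> power_reps s r (m - i))"
        using ns by (auto simp: power_reps_def a_def[symmetric] b_def[symmetric])
      then show "ns \<in> (\<lambda>(i, xs, ys). xs @ ys) `
          (SIGMA i:{0..m}. power_reps s t i \<times> power_reps s r (m - i))"
        by (rule rev_image_eqI) simp
    qed
  qed (auto simp: power_reps_def of_nat_diff)
qed

text \<open>Cardinalities are compared across the bijection; finiteness of the sets of
  representations turns the size of the disjoint union into a sum of products.\<close>

lemma W_add:
  assumes "s > 0" and "even s"
  shows "W s (t + r) m = (\<Sum>i=0..m. W s t i * W s r (m - i))"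
  using bij_betw_same_card[OF bij_betw_append_power_reps[OF assms(2), of m t r]] assms
  by (simp add: W_def finite_power_reps card_cartesian_product)

theorem lemmaG:
  fixes s t r :: nat
  assumes "s > 0" and "even s" and "t > 0" and "r > 0"
  shows "U (t + r) s = U t s * U r s"
  using assms by (simp add: fps_eq_iff fps_mult_nth U_def W_add)

end
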